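(* Let $X\subset\mathbb{P}_n$ be a Gorenstein projective subscheme of pure dimension $m\ge1$ and degree $d$, with characteristic sequence $(m_i)_{0\le i\le d-1}$. Let $Y,Y'\subset X$ be ACM hypersurfaces of $X$, with relative characteristic sequences $(n_i)_{0\le i\le d-1}$ and $(n_i')_{0\le i\le d-1}$ respectively, which are linked in the section $X\cap H$ of $X$ by a hypersurface $H\subset\mathbb{P}_n$ of degree $s$ cutting $X$ properly. Then for all $0\le i\le d-1$, $$n_i+n'_{d-1-i}=m_{d-1}+s.$$
   Context: $k$ is an algebraically closed field of characteristic $0$, $A_n=k[X_0,\dots,X_n]$. A projective subscheme $X\subset\mathbb{P}_n$ is given by its saturated homogeneous ideal $I_X$; $A_X=A_n/I_X$ and $\phi_X(l)=\dim_k A_X(l)$. $B[a](l)=B(a+l)$ denotes the shift of a graded module. $X$ of dimension $m$ is arithmetically Cohen-Macaulay (ACM) if $A_X$ admits a regular sequence of $m+1$ homogeneous polynomials. $X$ is Gorenstein (in the arithmetic sense) if it is ACM and the dualizing module satisfies $\omega_{A_X}\simeq A_X[a]$ for some integer $a$. A hypersurface $\{h=0\}$ cuts $X$ properly if multiplication by $h$ is injective on $A_X$. Characteristic sequence: if $X$ is ACM of pure dimension $m$ and degree $d$, and $Y_0,\dots,Y_m$ are linear forms whose common zero locus does not meet $X$, put $R_m=k[Y_0,\dots,Y_m]$. Then $A_X\simeq\bigoplus_{i=0}^{d-1}R_m[-m_i]$ as graded $R_m$-modules with $0=m_0\le\dots\le m_{d-1}$; the sequence $(m_i)$ depends only on $\phi_X$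 and is the characteristic sequence of $X$. Relative characteristic sequence: an ACM hypersurface of $X$ is an ACM closed subscheme $Y\subset X$ of pure dimension $m-1$. The kernel $I_{Y/X}=I_Y/I_X$ of $A_X\to A_Y$ is a graded free $R_m$-module of rank $d$, $I_{Y/X}\simeq\bigoplus_{i=0}^{d-1}R_m[-n_i]$ with $n_0\le\dots\le n_{d-1}$; $(n_i)$ is the relative characteristic sequence of $Y$ (relative to $X$). Linkage: let $V,V'$ be two subschemes and let $Z$ be defined by $I_Z=I_V\cap I_{V'}$. Multiplication gives a morphism of $A_n$-modules $I_{V'}\to\operatorname{Hom}_{A_n}(I_V,I_Z)$. One says that $V$ and $V'$ are linked in $Z$, and that $V'$ is the residual of $V$ in $Z$, if this morphism is an isomorphism. (Here $V=Y$, $V'=Y'$, $Z=X\cap H$.) *)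

theory Defs
  imports
    "HOL-Library.Poly_Mapping"
    "HOL-Library.FuncSet"
    "HOL-Library.Cardinality"
    "HOL-Computational_Algebra.Polynomial"
begin

section \<open>Homogeneous polynomials and ideals\<close>

text \<open>
  The ring \<open>A\<^sub>n = k[X\<^sub>0,\<dots>,X\<^sub>n]\<close> is the whole type below, for an index type \<open>'v\<close> of the
  variables with \<open>n + 1\<close> elements.
\<close>

type_synonym ('v, 'k) mpoly = "('v \<Rightarrow>\<^sub>0 nat) \<Rightarrow>\<^sub>0 'k"

definition tdeg :: "('v \<Rightarrow>\<^sub>0 nat) \<Rightarrow> nat" where
  "tdeg t = (\<Sum>v\<in>Poly_Mapping.keys t. Poly_Mapping.lookup t v)"

text \<open>Degrees are integers, so that shifts need no side conditions; \<open>forms l = {0}\<close> for \<open>l < 0\<close>.\<close>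

definition forms :: "int \<Rightarrow> ('v, 'k::zero) mpoly set" where
  "forms l = {p. \<forall>t\<in>Poly_Mapping.keys p. int (tdeg t) = l}"

definition hcomp :: "nat \<Rightarrow> ('v, 'k::comm_monoid_add) mpoly \<Rightarrow> ('v, 'k) mpoly" where
  "hcomp l p = (\<Sum>t\<in>{t \<in> Poly_Mapping.keys p. tdeg t = l}.
     Poly_Mapping.single t (Poly_Mapping.lookup p t))"

definition peval :: "('v::finite \<Rightarrow> 'k) \<Rightarrow> ('v, 'k::comm_semiring_1) mpoly \<Rightarrow> 'k" where
  "peval x p = (\<Sum>t\<in>Poly_Mapping.keys p.
     Poly_Mapping.lookup p t * (\<Prod>v\<in>UNIV. x v ^ Poly_Mapping.lookup t v))"

text \<open>Ideals are the submodules of the ring regarded as a module over itself.\<close>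

interpretation ideal: module "(*) :: 'a::comm_ring_1 \<Rightarrow> 'a \<Rightarrow> 'a"
  by unfold_locales (auto simp: algebra_simps)

abbreviation is_ideal :: "'a::comm_ring_1 set \<Rightarrow> bool" where
  "is_ideal \<equiv> module.subspace (*)"

abbreviation ideal_of :: "'a::comm_ring_1 set \<Rightarrow> 'a set" where
  "ideal_of \<equiv> module.span (*)"

definition hom_ideal :: "('v, 'k::comm_ring_1) mpoly set \<Rightarrow> bool" where
  "hom_ideal I \<longleftrightarrow> is_ideal I \<and> (\<forall>p\<in>I. \<forall>l. hcomp l p \<in> I)"

definition saturation :: "('v, 'k::comm_ring_1) mpoly set \<Rightarrow> ('v, 'k) mpoly set" where
  "saturation I = {p. \<exists>N. \<forall>q \<in> forms (int N). q * p \<in> I}"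

definition proj_subscheme :: "('v, 'k::comm_ring_1) mpoly set \<Rightarrow> bool" where
  "proj_subscheme I \<longleftrightarrow> hom_ideal I \<and> saturation I = I"

section \<open>Graded modules\<close>

text \<open>
  Graded modules over subrings of a ring \<open>'s\<close>; \<open>gpiece M l\<close> is the homogeneous part \<open>M(l)\<close>.
\<close>

record ('s, 'm) gmodule =
  gcarrier :: "'m set"
  gadd :: "'m \<Rightarrow> 'm \<Rightarrow> 'm"
  gsmult :: "'s \<Rightarrow> 'm \<Rightarrow> 'm"
  gpiece :: "int \<Rightarrow> 'm set"

definition gshift :: "('s, 'm) gmodule \<Rightarrow> int \<Rightarrow> ('s, 'm) gmodule" where
  "gshift M a = M\<lparr>gpiece := (\<lambda>l. gpiece M (a + l))\<rparr>"

definition gsum :: "nat \<Rightarrow> (nat \<Rightarrow> ('s, 'm) gmodule) \<Rightarrow> ('s, nat \<Rightarrow> 'm) gmodule" where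
  "gsum d M =
     \<lparr>gcarrier = (\<Pi>\<^sub>E i\<in>{..<d}. gcarrier (M i)),
      gadd = (\<lambda>u v. \<lambda>i\<in>{..<d}. gadd (M i) (u i) (v i)),
      gsmult = (\<lambda>r u. \<lambda>i\<in>{..<d}. gsmult (M i) r (u i)),
      gpiece = (\<lambda>l. \<Pi>\<^sub>E i\<in>{..<d}. gpiece (M i) l)\<rparr>"

definition ghoms :: "'s set \<Rightarrow> ('s, 'm) gmodule \<Rightarrow> ('s, 'n) gmodule \<Rightarrow> ('m \<Rightarrow> 'n) set" where
  "ghoms R M N = {\<phi> \<in> gcarrier M \<rightarrow>\<^sub>E gcarrier N.
     (\<forall>x\<in>gcarrier M. \<forall>y\<in>gcarrier M. \<phi> (gadd M x y) = gadd N (\<phi> x) (\<phi> y)) \<and>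
     (\<forall>r\<in>R. \<forall>x\<in>gcarrier M. \<phi> (gsmult M r x) = gsmult N r (\<phi> x))}"

text \<open>
  The module \<open>Hom\<^sub>R(M, N)\<close>. The scalars act through \<open>M\<close>, so that \<open>Hom\<^sub>R(M, N)\<close> is a module over
  any larger commutative ring that acts on \<open>M\<close>. All homomorphisms are admitted; when \<open>M\<close> is
  finitely generated they are the finite sums of homogeneous ones.
\<close>

definition gHom :: "'s set \<Rightarrow> ('s, 'm) gmodule \<Rightarrow> ('s, 'n) gmodule \<Rightarrow> ('s, 'm \<Rightarrow> 'n) gmodule" where
  "gHom R M N =
     \<lparr>gcarrier = ghoms R M N,
      gadd = (\<lambda>\<phi> \<psi>. \<lambda>x\<in>gcarrier M. gadd N (\<phi> x) (\<psi> x)),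
      gsmult = (\<lambda>s \<phi>. \<lambda>x\<in>gcarrier M. \<phi> (gsmult M s x)),
      gpiece = (\<lambda>l. {\<phi> \<in> ghoms R M N. \<forall>j. \<forall>x\<in>gpiece M j. \<phi> x \<in> gpiece N (j + l)})\<rparr>"

definition giso :: "'s set \<Rightarrow> ('s, 'm) gmodule \<Rightarrow> ('s, 'n) gmodule \<Rightarrow> bool" where
  "giso R M N \<longleftrightarrow> (\<exists>\<phi> \<in> ghoms R M N.
     bij_betw \<phi> (gcarrier M) (gcarrier N) \<and> (\<forall>l. \<phi> ` gpiece M l = gpiece N l))"

text \<open>Subsets of \<open>A\<^sub>n\<close> (an ideal or a graded subring), and subquotients \<open>J/I\<close> as sets of cosets.\<close>

definition submod :: "('v, 'k::comm_ring_1) mpoly set \<Rightarrow>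
    (('v, 'k) mpoly, ('v, 'k) mpoly) gmodule" where
  "submod J =
     \<lparr>gcarrier = J, gadd = (+), gsmult = (*), gpiece = (\<lambda>l. J \<inter> forms l)\<rparr>"

definition coset :: "'a::comm_ring_1 set \<Rightarrow> 'a \<Rightarrow> 'a set" where
  "coset I p = {p + q | q. q \<in> I}"

definition quotmod :: "('v, 'k::comm_ring_1) mpoly set \<Rightarrow> ('v, 'k) mpoly set \<Rightarrow>
    (('v, 'k) mpoly, ('v, 'k) mpoly set) gmodule" where
  "quotmod J I =
     \<lparr>gcarrier = coset I ` J,
      gadd = (\<lambda>A B. {a + b | a b. a \<in> A \<and> b \<in> B}),
      gsmult = (\<lambda>r A. {r * a + q | a q. a \<in> A \<and> q \<in> I}),
      gpiece = (\<lambda>l. coset I ` (J \<inter> forms l))\<rparr>"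

abbreviation coord_ring :: "('v, 'k::comm_ring_1) mpoly set \<Rightarrow>
    (('v, 'k) mpoly, ('v, 'k) mpoly set) gmodule" where
  "coord_ring I \<equiv> quotmod UNIV I"

lemma quotmod_add_coset:
  assumes "is_ideal I"
  shows "gadd (quotmod J I) (coset I p) (coset I q) = coset I (p + q)"
proof -
  have "\<exists>b c. p + q + a = b + c \<and> (\<exists>u. b = p + u \<and> u \<in> I) \<and> (\<exists>v. c = q + v \<and> v \<in> I)"
    if "a \<in> I" for a
    using that ideal.subspace_0[OF assms]
    by (intro exI[of _ "p + a"] exI[of _ q]) (auto simp: algebra_simps)
  moreover have "\<exists>w. p + u + (q + v) = p + q + w \<and> w \<in> I" if "u \<in> I" "v \<in> I" for u v
    using ideal.subspace_add[OF assms that] by (intro exI[of _ "u + v"]) (auto simp: algebra_simps)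
  ultimately show ?thesis
    by (auto simp: quotmod_def coset_def)
qed

lemma quotmod_smult_coset:
  assumes "is_ideal I"
  shows "gsmult (quotmod J I) r (coset I p) = coset I (r * p)"
proof -
  have "\<exists>w. r * (p + u) + v = r * p + w \<and> w \<in> I" if "u \<in> I" "v \<in> I" for u v
    using ideal.subspace_add[OF assms ideal.subspace_scale[OF assms that(1)] that(2)]
    by (intro exI[of _ "r * u + v"]) (auto simp: algebra_simps)
  moreover have "\<exists>b c. r * p + a = r * b + c \<and> (\<exists>u. b = p + u \<and> u \<in> I) \<and> c \<in> I" if "a \<in> I" for a
    using that ideal.subspace_0[OF assms] by (intro exI[of _ p] exI[of _ a]) auto
  ultimately show ?thesis
    by (auto simp: quotmod_def coset_def)
qed

section \<open>Dimension, degree, Cohen-Macaulay property\<close>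

text \<open>
  Irreducible closed subsets of \<open>\<P>\<^sub>n\<close> correspond to the homogeneous prime ideals which do not
  contain the irrelevant ideal.
\<close>

definition hom_prime :: "('v, 'k::comm_ring_1) mpoly set \<Rightarrow> bool" where
  "hom_prime P \<longleftrightarrow> hom_ideal P \<and> (\<forall>f g. f * g \<in> P \<longrightarrow> f \<in> P \<or> g \<in> P) \<and> \<not> forms 1 \<subseteq> P"

definition prime_chain :: "('v, 'k::comm_ring_1) mpoly set \<Rightarrow> nat \<Rightarrow> bool" where
  "prime_chain P r \<longleftrightarrow>
     (\<exists>Q. Q 0 = P \<and> (\<forall>i\<le>r. hom_prime (Q i)) \<and> (\<forall>i<r. Q i \<subset> Q (Suc i)))"

definition component :: "('v, 'k::comm_ring_1) mpoly set \<Rightarrow> ('v, 'k) mpoly set \<Rightarrow> bool" where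
  "component I P \<longleftrightarrow> hom_prime P \<and> I \<subseteq> P \<and> (\<forall>Q. hom_prime Q \<and> I \<subseteq> Q \<and> Q \<subseteq> P \<longrightarrow> Q = P)"

definition pure_dim :: "('v, 'k::comm_ring_1) mpoly set \<Rightarrow> nat \<Rightarrow> bool" where
  "pure_dim I m \<longleftrightarrow> I \<noteq> UNIV \<and>
     (\<forall>P. component I P \<longrightarrow> prime_chain P m \<and> \<not> prime_chain P (Suc m))"

definition hilbert :: "('v, 'k::field) mpoly set \<Rightarrow> nat \<Rightarrow> nat" where
  "hilbert I l =
     vector_space.dim (\<lambda>c p. Poly_Mapping.single 0 c * p) (forms (int l) :: ('v, 'k) mpoly set) -
     vector_space.dim (\<lambda>c p. Poly_Mapping.single 0 c * p) (I \<inter> forms (int l))"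

lemma vector_space_mpoly:
  "vector_space (\<lambda>(c::'k::field) (p::('v, 'k) mpoly). Poly_Mapping.single 0 c * p)"
proof
  fix a b :: 'k and x :: "('v, 'k) mpoly"
  have "Poly_Mapping.single (0::'v \<Rightarrow>\<^sub>0 nat) a * Poly_Mapping.single 0 b = Poly_Mapping.single 0 (a * b)"
    by (simp add: mult_single)
  then show "Poly_Mapping.single 0 a * (Poly_Mapping.single 0 b * x) = Poly_Mapping.single 0 (a * b) * x"
    by (simp only: mult.assoc[symmetric])
qed (simp_all add: distrib_left distrib_right single_add)

definition has_degree :: "('v, 'k::field) mpoly set \<Rightarrow> nat \<Rightarrow> nat \<Rightarrow> bool" where
  "has_degree I m d \<longleftrightarrow> (\<exists>P::rat poly.
     Polynomial.degree P = m \<and> lead_coeff P = of_nat d / fact m \<and>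
     (\<forall>\<^sub>F l in sequentially. of_nat (hilbert I l) = poly P (of_nat l)))"

definition cuts_properly :: "('v, 'k::comm_ring_1) mpoly set \<Rightarrow> ('v, 'k) mpoly \<Rightarrow> bool" where
  "cuts_properly I f \<longleftrightarrow> inj_on (gsmult (coord_ring I) f) (gcarrier (coord_ring I))"

definition regular_seq :: "('v, 'k::comm_ring_1) mpoly set \<Rightarrow> ('v, 'k) mpoly list \<Rightarrow> bool" where
  "regular_seq I fs \<longleftrightarrow>
     (\<forall>i<length fs. cuts_properly (ideal_of (I \<union> set (take i fs))) (fs ! i)) \<and>
     ideal_of (I \<union> set fs) \<noteq> UNIV"

definition ACM :: "('v, 'k::comm_ring_1) mpoly set \<Rightarrow> nat \<Rightarrow> bool" where
  "ACM I m \<longleftrightarrow> (\<exists>fs. length fs = m + 1 \<and> (\<forall>f\<in>set fs. \<exists>l. f \<in> forms l) \<and> regular_seq I fs)"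

definition ACM_hypersurface ::
    "('v, 'k::comm_ring_1) mpoly set \<Rightarrow> nat \<Rightarrow> ('v, 'k) mpoly set \<Rightarrow> bool" where
  "ACM_hypersurface I m J \<longleftrightarrow>
     proj_subscheme J \<and> I \<subseteq> J \<and> pure_dim J (m - 1) \<and> ACM J (m - 1)"

section \<open>The subring \<open>R\<^sub>m\<close>, characteristic sequences, dualizing module\<close>

inductive_set subalg :: "('v, 'k::comm_ring_1) mpoly set \<Rightarrow> ('v, 'k) mpoly set"
  for G :: "('v, 'k) mpoly set" where
  const: "Poly_Mapping.single 0 c \<in> subalg G"
| gen: "g \<in> G \<Longrightarrow> g \<in> subalg G"
| add: "p \<in> subalg G \<Longrightarrow> q \<in> subalg G \<Longrightarrow> p + q \<in> subalg G"
| mult: "p \<in> subalg G \<Longrightarrow> q \<in> subalg G \<Longrightarrow> p * q \<in> subalg G"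

abbreviation Rm :: "(nat \<Rightarrow> ('v, 'k::comm_ring_1) mpoly) \<Rightarrow> nat \<Rightarrow> ('v, 'k) mpoly set" where
  "Rm L m \<equiv> subalg (L ` {..m})"

definition linear_parameters ::
    "('v::finite, 'k::comm_ring_1) mpoly set \<Rightarrow> nat \<Rightarrow> (nat \<Rightarrow> ('v, 'k) mpoly) \<Rightarrow> bool" where
  "linear_parameters I m L \<longleftrightarrow> (\<forall>i\<le>m. L i \<in> forms 1) \<and>
     \<not> (\<exists>x. x \<noteq> (\<lambda>_. 0) \<and> (\<forall>f\<in>I. peval x f = 0) \<and> (\<forall>i\<le>m. peval x (L i) = 0))"

definition gfree :: "('v, 'k::comm_ring_1) mpoly set \<Rightarrow> nat \<Rightarrow> (nat \<Rightarrow> int) \<Rightarrow>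
    (('v, 'k) mpoly, nat \<Rightarrow> ('v, 'k) mpoly) gmodule" where
  "gfree R d e = gsum d (\<lambda>i. gshift (submod R) (- e i))"

definition rel_char_seq :: "('v, 'k::comm_ring_1) mpoly set \<Rightarrow> ('v, 'k) mpoly set \<Rightarrow>
    ('v, 'k) mpoly set \<Rightarrow> nat \<Rightarrow> (nat \<Rightarrow> int) \<Rightarrow> bool" where
  "rel_char_seq R I J d e \<longleftrightarrow>
     mono_on {..<d} e \<and> giso R (quotmod J I) (gfree R d e)"

definition char_seq :: "('v, 'k::comm_ring_1) mpoly set \<Rightarrow> ('v, 'k) mpoly set \<Rightarrow>
    nat \<Rightarrow> (nat \<Rightarrow> int) \<Rightarrow> bool" where
  "char_seq R I d e \<longleftrightarrow>
     e 0 = 0 \<and> mono_on {..<d} e \<and> giso R (coord_ring I) (gfree R d e)"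

text \<open>
  For an ACM subscheme of dimension \<open>m\<close>, \<open>A\<^sub>X\<close> is a finite Cohen-Macaulay algebra over the polynomial
  ring \<open>R = R\<^sub>m\<close> of the same dimension, whose dualizing module is \<open>R[-m-1]\<close>. The dualizing module
  of \<open>A\<^sub>X\<close> is therefore \<open>Hom\<^sub>R(A\<^sub>X, R[-m-1])\<close>, with the \<open>A\<^sub>n\<close>-module structure coming from \<open>A\<^sub>X\<close>.
  Up to isomorphism it does not depend on the linear forms chosen to form \<open>R\<close>.
\<close>

definition dualizing_module :: "('v, 'k::comm_ring_1) mpoly set \<Rightarrow> nat \<Rightarrow> ('v, 'k) mpoly set \<Rightarrow>
    (('v, 'k) mpoly, ('v, 'k) mpoly set \<Rightarrow> ('v, 'k) mpoly) gmodule" where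
  "dualizing_module R m I = gHom R (coord_ring I) (gshift (submod R) (- int (m + 1)))"

definition Gorenstein ::
    "('v, 'k::comm_ring_1) mpoly set \<Rightarrow> nat \<Rightarrow> ('v, 'k) mpoly set \<Rightarrow> bool" where
  "Gorenstein R m I \<longleftrightarrow>
     ACM I m \<and> (\<exists>a::int. giso UNIV (dualizing_module R m I) (gshift (coord_ring I) a))"

section \<open>Linkage\<close>

text \<open>The scheme-theoretic intersection of \<open>X\<close> with the hypersurface \<open>h = 0\<close>.\<close>

definition section_ideal :: "('v, 'k::comm_ring_1) mpoly set \<Rightarrow> ('v, 'k) mpoly \<Rightarrow>
    ('v, 'k) mpoly set" where
  "section_ideal I h = saturation (ideal_of (I \<union> {h}))"

definition linked_in :: "('v, 'k::comm_ring_1) mpoly set \<Rightarrow> ('v, 'k) mpoly set \<Rightarrow>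
    ('v, 'k) mpoly set \<Rightarrow> bool" where
  "linked_in V V' Z \<longleftrightarrow> Z = V \<inter> V' \<and>
     bij_betw (\<lambda>g. \<lambda>f\<in>V. g * f) V' (gcarrier (gHom UNIV (submod V) (submod Z)))"

end

theory Submission
  imports Defs "Jordan_Normal_Form.Determinant"
begin

text \<open>
  The isomorphism \<open>\<omega> \<simeq> A\<^sub>X[a]\<close> provides an \<open>R\<^sub>m\<close>-linear trace \<open>t : A\<^sub>X \<rightarrow> R\<^sub>m\<close>, homogeneous of
  some degree \<open>- c\<close>, such that every \<open>R\<^sub>m\<close>-linear form on \<open>A\<^sub>X\<close> is \<open>f \<mapsto> t (p f)\<close> for a unique \<open>p\<close>.
  For \<open>f \<in> J\<close> and \<open>g \<in> J'\<close> linkage gives \<open>f g = h w\<close> modulo \<open>I\<close>, and sending \<open>(f, g)\<close> to \<open>t w\<close> is a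
  perfect pairing of \<open>J/I\<close> and \<open>J'/I\<close> with values in \<open>R\<^sub>m\<close>. In homogeneous bases its matrix has an
  entry of degree \<open>\<nu> i + \<nu>' j - s - c\<close> at \<open>(i, j)\<close>. The constant terms form an invertible matrix
  over \<open>k\<close>, so some permutation \<open>\<sigma>\<close> satisfies \<open>\<nu> i + \<nu>' (\<sigma> i) = s + c\<close> for all \<open>i\<close>; as both
  sequences are sorted, \<open>\<sigma>\<close> may be taken to reverse the order. The case \<open>J = J' = A\<^sub>n\<close>, \<open>h = 1\<close> of the
  same argument gives \<open>c = \<mu> (d - 1)\<close>.
\<close>

\<comment> \<open>As a rewrite rule it loops together with \<open>mult.assoc\<close>.\<close>
declare ideal.scale_scale [simp del]

section \<open>Homogeneous components with integer degrees\<close>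

text \<open>Integer degrees allow expressions such as \<open>l - s\<close> without sign conditions.
  The value 0 in negative degree agrees with \<open>forms l\<close> being zero there.\<close>

definition gcomp :: "int \<Rightarrow> ('v, 'k::comm_monoid_add) mpoly \<Rightarrow> ('v, 'k) mpoly" where
  "gcomp l p = (if l < 0 then 0 else hcomp (nat l) p)"

lemma lookup_gcomp:
  "Poly_Mapping.lookup (gcomp l p) t = (if int (tdeg t) = l then Poly_Mapping.lookup p t else 0)"
proof -
  have "(\<Sum>u\<in>{u \<in> Poly_Mapping.keys p. tdeg u = nat l}. Poly_Mapping.lookup (Poly_Mapping.single u (Poly_Mapping.lookup p u)) t) =
      (\<Sum>u\<in>{u \<in> Poly_Mapping.keys p. tdeg u = nat l}. if u = t then Poly_Mapping.lookup p u else 0)"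
    by (rule sum.cong) (auto simp: lookup_single when_def)
  then show ?thesis
    by (auto simp: gcomp_def hcomp_def lookup_sum in_keys_iff)
qed

lemma gcomp_diff:
  fixes p q :: "('v, 'k::comm_ring_1) mpoly"
  shows "gcomp l (p - q) = gcomp l p - gcomp l q"
  by (rule poly_mapping_eqI) (simp add: lookup_gcomp lookup_minus)

lemma gcomp_sum: "gcomp l (sum f S) = (\<Sum>x\<in>S. gcomp l (f x))"
  by (rule poly_mapping_eqI) (simp add: lookup_gcomp lookup_sum)

lemma formsD: "p \<in> forms l \<Longrightarrow> int (tdeg t) \<noteq> l \<Longrightarrow> Poly_Mapping.lookup p t = 0"
  by (auto simp: forms_def in_keys_iff)

lemma gcomp_forms: "gcomp l p \<in> forms l"
  by (auto simp: forms_def in_keys_iff lookup_gcomp split: if_splits)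

lemma gcomp_of_form:
  assumes "p \<in> forms l"
  shows "gcomp l' p = (if l' = l then p else 0)"
  using assms by (intro poly_mapping_eqI) (auto simp: lookup_gcomp dest: formsD)

lemma gcomp_in_hom_ideal: "hom_ideal I \<Longrightarrow> p \<in> I \<Longrightarrow> gcomp l p \<in> I"
  by (auto simp: hom_ideal_def gcomp_def intro: ideal.subspace_0)

lemma tdeg_add: "tdeg (s + t) = tdeg s + tdeg t"
proof -
  let ?S = "Poly_Mapping.keys s \<union> Poly_Mapping.keys t"
  have "tdeg u = (\<Sum>v\<in>?S. Poly_Mapping.lookup u v)" if "Poly_Mapping.keys u \<subseteq> ?S" for u
    unfolding tdeg_def using that by (intro sum.mono_neutral_left) (auto simp: in_keys_iff)
  then show ?thesis
    using Poly_Mapping.keys_add[of s t] by (simp add: lookup_add sum.distrib)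
qed

lemma tdeg_zero [simp]: "tdeg 0 = 0"
  by (simp add: tdeg_def)

lemma tdeg_eq_0_iff: "tdeg t = 0 \<longleftrightarrow> t = 0"
  by (auto simp: tdeg_def in_keys_iff intro!: poly_mapping_eqI)

lemma forms_mult:
  assumes "p \<in> forms a" "q \<in> forms b"
  shows "p * q \<in> forms (a + b)"
  using assms Poly_Mapping.keys_mult[of p q] unfolding forms_def by (fastforce simp: tdeg_add)

lemma zero_in_forms: "0 \<in> forms l"
  by (simp add: forms_def)

lemma one_in_forms: "1 \<in> forms 0"
  by (simp add: forms_def)

lemma forms_power: "p \<in> forms a \<Longrightarrow> p ^ k \<in> forms (int k * a)"
  by (induction k) (auto simp: one_in_forms algebra_simps dest: forms_mult)

lemma poly_mapping_sum_keys: "p = (\<Sum>t\<in>Poly_Mapping.keys p. Poly_Mapping.single t (Poly_Mapping.lookup p t))"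
proof (rule poly_mapping_eqI)
  fix t
  have "(\<Sum>u\<in>Poly_Mapping.keys p. Poly_Mapping.lookup (Poly_Mapping.single u (Poly_Mapping.lookup p u)) t) =
      (\<Sum>u\<in>Poly_Mapping.keys p. if u = t then Poly_Mapping.lookup p u else 0)"
    by (rule sum.cong) (auto simp: lookup_single when_def)
  then show "Poly_Mapping.lookup p t = Poly_Mapping.lookup (\<Sum>t\<in>Poly_Mapping.keys p. Poly_Mapping.single t (Poly_Mapping.lookup p t)) t"
    by (auto simp: lookup_sum in_keys_iff)
qed

lemma single_in_forms: "Poly_Mapping.single t c \<in> forms (int (tdeg t))"
  by (simp add: forms_def)

text \<open>By additivity it suffices to take a single term for \<open>p\<close>, where both sides
  are forms of known degree. This allows a quotient by a form \<open>h\<close> to be replaced by one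
  of its homogeneous components.\<close>

lemma gcomp_mult_form:
  fixes h p :: "('v, 'k::comm_ring_1) mpoly"
  assumes h: "h \<in> forms s"
  shows "gcomp (l + s) (h * p) = h * gcomp l p"
proof -
  have "gcomp (l + s) (h * Poly_Mapping.single t c) = h * gcomp l (Poly_Mapping.single t c)" for t c
    using gcomp_of_form[OF forms_mult[OF h single_in_forms[of t c]], of "l + s"]
      gcomp_of_form[OF single_in_forms[of t c], of l] by (auto simp: algebra_simps)
  then show ?thesis
    by (subst (1 2) poly_mapping_sum_keys[of p]) (simp add: sum_distrib_left gcomp_sum)
qed

text \<open>Exponents add up to 0 only if both are 0, so taking constant terms is multiplicative. A
  matrix identity over the polynomial ring thereby descends to one over the coefficients.\<close>

lemma lookup_mult_0:
  fixes p q :: "('v, 'k::comm_ring_1) mpoly"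
  shows "Poly_Mapping.lookup (p * q) 0 = Poly_Mapping.lookup p 0 * Poly_Mapping.lookup q 0"
proof -
  have *: "s + t = 0 \<longleftrightarrow> s = 0 \<and> t = 0" for s t :: "'v \<Rightarrow>\<^sub>0 nat"
    by (metis add_is_0 tdeg_add tdeg_eq_0_iff)
  have 1: "Poly_Mapping.lookup (Poly_Mapping.single s a * Poly_Mapping.single t b) 0 =
      Poly_Mapping.lookup (Poly_Mapping.single s a) 0 * Poly_Mapping.lookup (Poly_Mapping.single t b) 0" for s t :: "'v \<Rightarrow>\<^sub>0 nat" and a b :: 'k
    by (auto simp: mult_single lookup_single when_def *)
  have 2: "Poly_Mapping.lookup (Poly_Mapping.single s a * q) 0 = Poly_Mapping.lookup (Poly_Mapping.single s a) 0 * Poly_Mapping.lookup q 0"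
    for s :: "'v \<Rightarrow>\<^sub>0 nat" and a :: 'k
    by (subst (1 2) poly_mapping_sum_keys[of q]) (simp add: sum_distrib_left lookup_sum 1)
  show ?thesis
    by (subst (1 2) poly_mapping_sum_keys[of p]) (simp add: sum_distrib_right lookup_sum 2)
qed

lemma lookup_one_0: "Poly_Mapping.lookup (1 :: ('v, 'k::comm_ring_1) mpoly) 0 = 1"
  by (simp add: lookup_one)

section \<open>Permutations from invertible matrices, and sorted sequences\<close>

text \<open>\<open>M\<close> has a right inverse, hence nonzero determinant, so some term of the
  Leibniz expansion is nonzero.\<close>

lemma nonzero_products_permutation:
  fixes M N :: "nat \<Rightarrow> nat \<Rightarrow> 'k::field"
  assumes "\<And>i k. i < d \<Longrightarrow> k < d \<Longrightarrow> (\<Sum>j<d. M i j * N j k) = (if i = k then 1 else 0)"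
  obtains \<sigma> where "\<sigma> permutes {..<d}" "\<And>i. i < d \<Longrightarrow> M i (\<sigma> i) \<noteq> 0"
proof -
  let ?M = "mat d d (\<lambda>(i, j). M i j)" and ?N = "mat d d (\<lambda>(i, j). N i j)"
  have "?M * ?N = 1\<^sub>m d"
    using assms by (intro eq_matI) (auto simp: scalar_prod_def atLeast0LessThan)
  then have "det ?M * det ?N = 1"
    by (metis det_mult det_one mat_carrier)
  then have "det ?M \<noteq> 0"
    by auto
  then obtain p where p: "p permutes {0..<d}" "(\<Prod>i = 0..<d. ?M $$ (i, p i)) \<noteq> 0"
    unfolding det_def'[OF mat_carrier] by (metis (no_types, lifting) mem_Collect_eq mult_zero_right sum.neutral)
  have "M i (p i) \<noteq> 0" if "i < d" for i
  proof -
    have "p i < d"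
      using permutes_in_image[OF p(1), of i] that by auto
    then show ?thesis
      using p(2) that by (auto dest: bspec[where x = i])
  qed
  then show thesis
    using p(1) that[of p] by (simp add: atLeast0LessThan)
qed

lemma permuted_complement_sorted:
  fixes a b :: "nat \<Rightarrow> int"
  assumes a: "mono_on {..<d} a" and b: "mono_on {..<d} b"
    and \<sigma>: "\<sigma> permutes {..<d}" and eq: "\<And>i. i < d \<Longrightarrow> a i + b (\<sigma> i) = C"
    and i: "i < d"
  shows "a i + b (d - 1 - i) = C"
proof (rule ccontr)
  have \<sigma>_less: "\<sigma> j < d" if "j < d" for j
    using permutes_in_image[OF \<sigma>, of j] that by auto
  have inj: "inj_on \<sigma> S" for S
    using permutes_inj[OF \<sigma>] by (rule inj_on_subset) auto
  assume "a i + b (d - 1 - i) \<noteq> C"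
  then consider "a i + b (d - 1 - i) > C" | "a i + b (d - 1 - i) < C"
    by linarith
  then show False
  proof cases
    case 1
    \<comment> \<open>Pigeonhole: by monotonicity, an index \<open>j \<ge> i\<close> with
      \<open>\<sigma> j \<ge> d - 1 - i\<close> would have sum above \<open>C\<close>. Thus
      \<open>d - i\<close> indices would share \<open>d - 1 - i\<close> places.\<close>
    have "\<sigma> ` {i..<d} \<subseteq> {..<d - 1 - i}"
    proof (rule image_subsetI, rule ccontr)
      fix j assume j: "j \<in> {i..<d}" "\<sigma> j \<notin> {..<d - 1 - i}"
      then have "a i \<le> a j" "b (d - 1 - i) \<le> b (\<sigma> j)"
        using i \<sigma>_less[of j] by (auto intro!: mono_onD[OF a] mono_onD[OF b])
      with 1 eq[of j] j show False
        by auto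
    qed
    then have "card {i..<d} \<le> card {..<d - 1 - i}"
      by (intro card_inj_on_le[OF inj]) auto
    with i show False
      by simp
  next
    case 2
    \<comment> \<open>Symmetrically, the \<open>i + 1\<close> indices up to \<open>i\<close> would
      share the \<open>i\<close> places from \<open>d - i\<close> on.\<close>
    have "\<sigma> ` {..i} \<subseteq> {d - i..<d}"
    proof (rule image_subsetI, rule ccontr)
      fix j assume j: "j \<in> {..i}" "\<sigma> j \<notin> {d - i..<d}"
      then have "a j \<le> a i" "b (\<sigma> j) \<le> b (d - 1 - i)"
        using i \<sigma>_less[of j] by (auto intro!: mono_onD[OF a] mono_onD[OF b])
      with 2 eq[of j] j i show False
        by auto
    qed
    then have "card {..i} \<le> card {d - i..<d}"
      by (intro card_inj_on_le[OF inj]) auto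
    with i show False
      by simp
  qed
qed

section \<open>The perfect pairing given by a linkage\<close>

text \<open>
  A homogeneous basis \<open>b\<close> of \<open>J/I\<close> over \<open>R\<close>, with \<open>b\<close> represented in \<open>J\<close> and the coordinate
  functions \<open>c\<close> lifted to \<open>J\<close>.
\<close>

locale graded_basis =
  fixes R I J :: "('v, 'k::comm_ring_1) mpoly set" and d :: nat and e :: "nat \<Rightarrow> int"
    and b :: "nat \<Rightarrow> ('v, 'k) mpoly" and c :: "nat \<Rightarrow> ('v, 'k) mpoly \<Rightarrow> ('v, 'k) mpoly"
  assumes basis_in: "i < d \<Longrightarrow> b i \<in> J"
    and basis_form: "i < d \<Longrightarrow> b i \<in> forms (e i)"
    and coord_in: "i < d \<Longrightarrow> f \<in> J \<Longrightarrow> c i f \<in> R"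
    and coord_add: "i < d \<Longrightarrow> f \<in> J \<Longrightarrow> g \<in> J \<Longrightarrow> c i (f + g) = c i f + c i g"
    and coord_scale: "i < d \<Longrightarrow> r \<in> R \<Longrightarrow> f \<in> J \<Longrightarrow> c i (r * f) = r * c i f"
    and coord_zero: "i < d \<Longrightarrow> f \<in> I \<Longrightarrow> c i f = 0"
    and coord_basis: "i < d \<Longrightarrow> j < d \<Longrightarrow> c i (b j) = (if i = j then 1 else 0)"
    and expansion: "f \<in> J \<Longrightarrow> f - (\<Sum>i<d. c i f * b i) \<in> I"

text \<open>
  A generator \<open>t\<close> of \<open>Hom\<^sub>R(A/I, R)\<close> over \<open>A\<close>, lifted to \<open>A\<close> and homogeneous of degree \<open>- a\<close>.
\<close>

locale trace_form =
  fixes R I :: "('v, 'k::comm_ring_1) mpoly set" and a :: int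
    and t :: "('v, 'k) mpoly \<Rightarrow> ('v, 'k) mpoly"
  assumes trace_add: "t (p + q) = t p + t q"
    and trace_scale: "r \<in> R \<Longrightarrow> t (r * p) = r * t p"
    and trace_zero: "p \<in> I \<Longrightarrow> t p = 0"
    and trace_form: "p \<in> forms l \<Longrightarrow> t p \<in> forms (l - a)"
    and trace_repr: "(\<And>f. \<psi> f \<in> R) \<Longrightarrow> (\<And>f g. \<psi> (f + g) = \<psi> f + \<psi> g) \<Longrightarrow>
      (\<And>r f. r \<in> R \<Longrightarrow> \<psi> (r * f) = r * \<psi> f) \<Longrightarrow> (\<And>f. f \<in> I \<Longrightarrow> \<psi> f = 0) \<Longrightarrow>
      \<exists>p. \<forall>f. \<psi> f = t (p * f)"
    and trace_nondegenerate: "(\<And>f. t (p * f) = 0) \<Longrightarrow> p \<in> I"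
begin

lemma trace_diff: "t (p - q) = t p - t q"
  using trace_add[of "p - q" q] by (simp add: algebra_simps)

lemma trace_cong: "p - q \<in> I \<Longrightarrow> t p = t q"
  using trace_zero[of "p - q"] by (simp add: trace_diff)

lemma trace_sum: "finite S \<Longrightarrow> t (sum f S) = (\<Sum>x\<in>S. t (f x))"
proof (induction S rule: finite_induct)
  case empty
  show ?case
    using trace_add[of 0 0] by simp
qed (simp add: trace_add)

end

lemma lookup_sum_mult_0:
  fixes f g :: "'i \<Rightarrow> ('v, 'k::comm_ring_1) mpoly"
  shows "Poly_Mapping.lookup (\<Sum>i\<in>S. f i * g i) 0 =
    (\<Sum>i\<in>S. Poly_Mapping.lookup (f i) 0 * Poly_Mapping.lookup (g i) 0)"
  by (simp add: lookup_sum lookup_mult_0)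

text \<open>The assumptions \<open>prod\<close> and \<open>colon\<close> say that \<open>J'\<close>
  is the ideal quotient of \<open>I + (h)\<close> by \<open>J\<close>. The pairing is shown to be
  perfect by exhibiting in \<open>J'\<close> the dual basis of \<open>b\<close>. A general form
  \<open>h\<close> is allowed so that \<open>h = 1\<close> is covered as well.\<close>

lemma linkage_pairing_permutation:
  fixes I J J' R :: "('v, 'k::field) mpoly set"
  assumes "graded_basis R I J d e b c" and "graded_basis R I J' d e' b' c'"
    and "trace_form R I a t"
    and I: "hom_ideal I" and J: "is_ideal J" and R: "0 \<in> R"
    and h: "h \<in> forms s" "h \<in> J"
    and nzd: "\<And>p. h * p \<in> I \<Longrightarrow> p \<in> I"
    and prod: "\<And>f g. f \<in> J \<Longrightarrow> g \<in> J' \<Longrightarrow> \<exists>w. f * g - h * w \<in> I"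
    and colon: "\<And>g. (\<And>f. f \<in> J \<Longrightarrow> \<exists>w. g * f - h * w \<in> I) \<Longrightarrow> g \<in> J'"
    and IJ: "I \<subseteq> J"
  obtains \<sigma> where "\<sigma> permutes {..<d}" "\<And>i. i < d \<Longrightarrow> e i + e' (\<sigma> i) = a + s"
proof -
  interpret B: graded_basis R I J d e b c by fact
  interpret B': graded_basis R I J' d e' b' c' by fact
  interpret trace_form R I a t by fact
  have ideal_I: "is_ideal I"
    using I by (simp add: hom_ideal_def)
  note in_J = ideal.subspace_scale[OF J]
  \<comment> \<open>\<open>P k f\<close> represents, through the trace, the linear form
    \<open>q \<mapsto> c k (q * f)\<close> on the ring.\<close>
  define P where "P k f = (SOME p. \<forall>q. c k (q * f) = t (p * q))" for k f
  have "\<exists>p. \<forall>q. c k (q * f) = t (p * q)" if "k < d" "f \<in> J" for k f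
  proof (rule trace_repr)
    show "c k (q * f) \<in> R" for q
      by (intro B.coord_in in_J that)
    show "c k ((p + q) * f) = c k (p * f) + c k (q * f)" for p q
      unfolding distrib_right by (intro B.coord_add in_J that)
    show "c k (r * q * f) = r * c k (q * f)" if "r \<in> R" for r q
      unfolding mult.assoc by (intro B.coord_scale in_J \<open>k < d\<close> \<open>f \<in> J\<close> that)
    show "c k (q * f) = 0" if "q \<in> I" for q
      using ideal.subspace_scale[OF ideal_I that, of f]
      by (intro B.coord_zero \<open>k < d\<close>) (simp add: mult.commute)
  qed
  note trace_ex = this
  have P: "c k (q * f) = t (P k f * q)" if "k < d" "f \<in> J" for k f q
    using someI_ex[OF trace_ex[OF that]] unfolding P_def by (rule spec)
  \<comment> \<open>The dual basis. Since \<open>G k * f\<close> equals \<open>h * P k f\<close>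
    modulo \<open>I\<close>, the pairing of \<open>f\<close> with \<open>G k\<close> is
    \<open>t (P k f) = c k f\<close>.\<close>
  define G where "G k = P k h" for k
  have G: "G k * f - h * P k f \<in> I" if "k < d" "f \<in> J" for k f
  proof (rule trace_nondegenerate)
    fix q
    have "(G k * f - h * P k f) * q = P k h * (f * q) - P k f * (h * q)"
      by (simp add: G_def algebra_simps)
    moreover have "t (P k h * (f * q)) = t (P k f * (h * q))"
      \<comment> \<open>Both sides are \<open>c k (f * q * h)\<close>, read once with
        \<open>h\<close> and once with \<open>f\<close> as the element of \<open>J\<close>.\<close>
      unfolding P[OF that(1) h(2), symmetric] P[OF that, symmetric] by (simp only: mult_ac)
    ultimately show "t ((G k * f - h * P k f) * q) = 0"
      by (simp only: trace_diff diff_self)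
  qed
  have G_J': "G k \<in> J'" if "k < d" for k
    by (rule colon) (rule exI, rule G[OF that])
  define W where "W i j = (SOME w. b i * b' j - h * w \<in> I)" for i j
  have W: "b i * b' j - h * W i j \<in> I" if "i < d" "j < d" for i j
    unfolding W_def by (rule someI_ex[OF prod[OF B.basis_in[OF that(1)] B'.basis_in[OF that(2)]]])
  \<comment> \<open>\<open>M\<close> is the matrix of the pairing in the bases \<open>b\<close> and
    \<open>b'\<close>; \<open>N\<close> contains the coordinates of the dual basis in
    \<open>b'\<close>.\<close>
  define M where "M i j = t (W i j)" for i j
  define N where "N j k = c' j (G k)" for j k
  have N_in: "N j k \<in> R" if "j < d" "k < d" for j k
    using that G_J' B'.coord_in by (simp add: N_def)
  have MN: "(\<Sum>j<d. M i j * N j k) = (if i = k then 1 else 0)" if i: "i < d" and k: "k < d" for i k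
  proof -
    let ?S = "\<Sum>j<d. N j k * W i j"
    have 1: "(\<Sum>j<d. N j k * (b i * b' j - h * W i j)) \<in> I"
      using W i by (intro ideal.subspace_sum[OF ideal_I] ideal.subspace_scale[OF ideal_I]) auto
    have 2: "b i * (G k - (\<Sum>j<d. N j k * b' j)) \<in> I"
      unfolding N_def by (intro ideal.subspace_scale[OF ideal_I] B'.expansion G_J' k)
    have 3: "G k * b i - h * P k (b i) \<in> I"
      by (intro G k B.basis_in i)
    \<comment> \<open>Expanding \<open>G k\<close> in \<open>b'\<close> gives two quotients by
      \<open>h\<close> of \<open>b i * G k\<close> modulo \<open>I\<close>; cancelling
      \<open>h\<close> shows that they have the same trace.\<close>
    have "h * (?S - P k (b i)) = (G k * b i - h * P k (b i)) -
        b i * (G k - (\<Sum>j<d. N j k * b' j)) - (\<Sum>j<d. N j k * (b i * b' j - h * W i j))"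
      by (simp add: algebra_simps sum_subtractf sum_distrib_left)
    also have "\<dots> \<in> I"
      by (rule ideal.subspace_diff[OF ideal_I ideal.subspace_diff[OF ideal_I 3 2] 1])
    finally have "t ?S = t (P k (b i))"
      by (rule trace_cong[OF nzd])
    also have "\<dots> = c k (b i)"
      using P[OF k B.basis_in[OF i], of 1] by (simp only: mult_1_left mult_1_right)
    finally have "t ?S = (if i = k then 1 else 0)"
      by (simp only: B.coord_basis[OF k i] eq_commute[of k i])
    then show ?thesis
      using k by (simp add: trace_sum trace_scale N_in M_def mult.commute)
  qed
  have "(\<Sum>j<d. Poly_Mapping.lookup (M i j) 0 * Poly_Mapping.lookup (N j k) 0) =
      (if i = k then 1 else 0)" if "i < d" "k < d" for i k
    using MN[OF that] lookup_one_0[where 'v='v and 'k='k]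
    by (simp flip: lookup_sum_mult_0)
  from nonzero_products_permutation[OF this] obtain \<sigma> where \<sigma>: "\<sigma> permutes {..<d}"
    "\<And>i. i < d \<Longrightarrow> Poly_Mapping.lookup (M i (\<sigma> i)) 0 \<noteq> 0" by blast
  \<comment> \<open>Replacing \<open>W i j\<close> by its component of degree
    \<open>e i + e' j - s\<close> does not change its trace, so \<open>M i j\<close> is homogeneous.
    A nonzero constant term then forces its degree to be 0.\<close>
  have "e i + e' j = a + s"
    if ij: "i < d" "j < d" and nz: "Poly_Mapping.lookup (M i j) 0 \<noteq> 0" for i j
  proof -
    let ?l = "e i + e' j"
    have "gcomp ?l (b i * b' j - h * W i j) \<in> I"
      by (intro gcomp_in_hom_ideal I W ij)
    moreover have "b i * b' j \<in> forms ?l"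
      by (intro forms_mult B.basis_form B'.basis_form ij)
    ultimately have "b i * b' j - h * gcomp (?l - s) (W i j) \<in> I"
      using gcomp_mult_form[OF h(1), of "?l - s" "W i j"] by (simp add: gcomp_diff gcomp_of_form)
    with W[OF ij] have "h * (gcomp (?l - s) (W i j) - W i j) \<in> I"
      using ideal.subspace_diff[OF ideal_I] by (fastforce simp: algebra_simps)
    then have "t (gcomp (?l - s) (W i j)) = M i j"
      unfolding M_def by (rule trace_cong[OF nzd])
    then have "M i j \<in> forms (?l - s - a)"
      using trace_form[OF gcomp_forms, of "?l - s" "W i j"] by simp
    with nz show ?thesis
      using formsD[of "M i j" "?l - s - a" 0] by fastforce
  qed
  moreover have "\<sigma> i < d" if "i < d" for i
    using permutes_in_image[OF \<sigma>(1), of i] that by auto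
  ultimately show thesis
    using \<sigma> that[of \<sigma>] by blast
qed

section \<open>Bases and trace from the graded isomorphisms\<close>

lemma coset_eq_iff:
  fixes I :: "'a::comm_ring_1 set"
  assumes I: "is_ideal I"
  shows "coset I p = coset I q \<longleftrightarrow> p - q \<in> I"
proof
  assume "coset I p = coset I q"
  moreover have "p \<in> coset I p"
    using ideal.subspace_0[OF I] by (auto simp: coset_def)
  ultimately show "p - q \<in> I"
    by (auto simp: coset_def)
next
  assume pq: "p - q \<in> I"
  have "p + r \<in> coset I q" "q + r \<in> coset I p" if "r \<in> I" for r
    using ideal.subspace_add[OF I pq that] ideal.subspace_diff[OF I that pq]
    by (auto simp: coset_def algebra_simps intro: exI[of _ "p - q + r"] exI[of _ "r - (p - q)"])
  then show "coset I p = coset I q"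
    by (auto simp: coset_def)
qed

lemma cuts_properly_iff:
  assumes I: "is_ideal I"
  shows "cuts_properly I f \<longleftrightarrow> (\<forall>p. f * p \<in> I \<longrightarrow> p \<in> I)"
proof -
  have "cuts_properly I f \<longleftrightarrow> (\<forall>p q. f * p - f * q \<in> I \<longrightarrow> p - q \<in> I)"
    unfolding cuts_properly_def inj_on_def
    using quotmod_smult_coset[OF I, of UNIV] coset_eq_iff[OF I] by (simp add: quotmod_def)
  also have "\<dots> \<longleftrightarrow> (\<forall>p q. f * (p - q) \<in> I \<longrightarrow> p - q \<in> I)"
    by (simp add: right_diff_distrib)
  also have "\<dots> \<longleftrightarrow> (\<forall>p. f * p \<in> I \<longrightarrow> p \<in> I)"
    by (metis diff_zero)
  finally show ?thesis .
qed

lemma ideal_of_insert_iff: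
  fixes I :: "'a::comm_ring_1 set"
  assumes I: "is_ideal I"
  shows "p \<in> ideal_of (I \<union> {h}) \<longleftrightarrow> (\<exists>w. p - h * w \<in> I)"
proof -
  have span_I: "ideal_of I = I"
    using I by (simp only: ideal.span_eq_iff)
  show ?thesis
    using ideal.span_breakdown_eq[of p h I] unfolding span_I by (simp add: mult.commute)
qed

lemma subalg_0 [simp]: "0 \<in> subalg G"
  using subalg.const[of 0 G] by simp

lemma subalg_1 [simp]: "1 \<in> subalg G"
  using subalg.const[of 1 G] by simp

lemma gfree_simps:
  "gcarrier (gfree R d e) = (\<Pi>\<^sub>E i\<in>{..<d}. R)"
  "gadd (gfree R d e) u v = (\<lambda>i\<in>{..<d}. u i + v i)"
  "gsmult (gfree R d e) r u = (\<lambda>i\<in>{..<d}. r * u i)"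
  "gpiece (gfree R d e) l = (\<Pi>\<^sub>E i\<in>{..<d}. R \<inter> forms (l - e i))"
  by (simp_all add: gfree_def gsum_def gshift_def submod_def algebra_simps)

text \<open>The basis is the preimage of the standard basis. Because the isomorphism maps each
  graded piece onto the corresponding one, representatives can be chosen homogeneous.\<close>

lemma graded_basis_of_giso:
  fixes I J :: "('v, 'k::comm_ring_1) mpoly set"
  assumes I: "is_ideal I" and J: "is_ideal J" and IJ: "I \<subseteq> J"
    and R: "R = subalg G"
    and iso: "giso R (quotmod J I) (gfree R d e)"
  obtains b c where "graded_basis R I J d e b c"
proof -
  let ?F = "gfree R d e"
  obtain \<phi> where hom: "\<phi> \<in> ghoms R (quotmod J I) ?F"
    and bij: "bij_betw \<phi> (coset I ` J) (gcarrier ?F)"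
    and pieces: "\<And>l. \<phi> ` coset I ` (J \<inter> forms l) = gpiece ?F l"
    using iso by (auto simp: giso_def quotmod_def)
  define c where "c i f = \<phi> (coset I f) i" for i f
  have \<phi>_in: "\<phi> (coset I f) \<in> (\<Pi>\<^sub>E i\<in>{..<d}. R)" if "f \<in> J" for f
    using hom that by (auto simp: ghoms_def quotmod_def gfree_simps(1))
  have c_add: "c i (f + g) = c i f + c i g" if "i < d" "f \<in> J" "g \<in> J" for i f g
  proof -
    have "\<phi> (gadd (quotmod J I) (coset I f) (coset I g)) = gadd ?F (\<phi> (coset I f)) (\<phi> (coset I g))"
      using hom that by (simp add: ghoms_def quotmod_def)
    then show ?thesis
      using that(1) by (simp add: quotmod_add_coset[OF I] gfree_simps c_def)
  qed
  have c_scale: "c i (r * f) = r * c i f" if "i < d" "r \<in> R" "f \<in> J" for i r f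
  proof -
    have "\<phi> (gsmult (quotmod J I) r (coset I f)) = gsmult ?F r (\<phi> (coset I f))"
      using hom that by (simp add: ghoms_def quotmod_def)
    then show ?thesis
      using that(1) by (simp add: quotmod_smult_coset[OF I] gfree_simps c_def)
  qed
  have c_0: "c i 0 = 0" if "i < d" for i
    using c_add[OF that, of 0 0] ideal.subspace_0[OF J] by simp
  have c_zero: "c i f = 0" if "i < d" "f \<in> I" for i f
    using c_0[OF that(1)] coset_eq_iff[OF I, of f 0] that(2) by (simp add: c_def)
  have c_sum: "c i (sum g S) = (\<Sum>x\<in>S. c i (g x))"
    if "i < d" "finite S" "\<And>x. x \<in> S \<Longrightarrow> g x \<in> J" for i g and S :: "nat set"
    using that(2,3)
    by (induction S rule: finite_induct)
      (simp_all add: c_0 c_add that(1) ideal.subspace_sum[OF J])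
  define b where "b i = (SOME f. f \<in> J \<inter> forms (e i) \<and>
      \<phi> (coset I f) = (\<lambda>j\<in>{..<d}. if j = i then 1 else 0))" for i
  have b: "b i \<in> J \<inter> forms (e i) \<and> \<phi> (coset I (b i)) = (\<lambda>j\<in>{..<d}. if j = i then 1 else 0)" for i
    unfolding b_def
  proof (rule someI_ex)
    \<comment> \<open>The shift by \<open>- e i\<close> places the entry 1 in degree
      \<open>e i\<close>; the zero entries lie in every degree.\<close>
    have "(\<lambda>j\<in>{..<d}. if j = i then 1 else 0) \<in> gpiece ?F (e i)"
      by (auto simp: gfree_simps R one_in_forms zero_in_forms)
    then show "\<exists>f. f \<in> J \<inter> forms (e i) \<and> \<phi> (coset I f) = (\<lambda>j\<in>{..<d}. if j = i then 1 else 0)"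
      unfolding pieces[symmetric] by force
  qed
  have expansion: "f - (\<Sum>i<d. c i f * b i) \<in> I" if f: "f \<in> J" for f
  proof -
    let ?g = "\<Sum>i<d. c i f * b i"
    have c_R: "c i f \<in> R" if "i < d" for i
      using \<phi>_in[OF f] that by (auto simp: c_def)
    have g: "?g \<in> J"
      using b by (intro ideal.subspace_sum[OF J] ideal.subspace_scale[OF J]) auto
    have "c j ?g = c j f" if j: "j < d" for j
    proof -
      have "c j ?g = (\<Sum>i<d. c j (c i f * b i))"
        using b by (intro c_sum j ideal.subspace_scale[OF J]) auto
      also have "\<dots> = (\<Sum>i<d. c i f * c j (b i))"
        using b c_R by (intro sum.cong c_scale j) auto
      also have "\<dots> = (\<Sum>i<d. if j = i then c i f else 0)"
        using b j by (intro sum.cong) (simp_all add: c_def)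
      finally show ?thesis
        using j by simp
    qed
    then have "\<phi> (coset I f) = \<phi> (coset I ?g)"
      using PiE_ext[OF \<phi>_in[OF f] \<phi>_in[OF g]] by (simp add: c_def)
    then have "coset I f = coset I ?g"
      using inj_onD[OF bij_betw_imp_inj_on[OF bij]] f g by blast
    then show ?thesis
      by (simp only: coset_eq_iff[OF I])
  qed
  have "graded_basis R I J d e b c"
  proof
    show "c i f \<in> R" if "i < d" "f \<in> J" for i f
      using \<phi>_in[OF that(2)] that(1) by (auto simp: c_def)
    show "c i (b j) = (if i = j then 1 else 0)" if "i < d" "j < d" for i j
      using b[of j] that by (simp add: c_def)
  qed (use b c_add c_scale c_zero expansion in auto)
  then show thesis
    by (rule that)
qed

text \<open>The trace is the generator of the dualizing module that corresponds to 1. Injectivity of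
  the isomorphism gives both nondegeneracy and the representation of linear forms.\<close>

lemma trace_form_of_Gorenstein:
  fixes I :: "('v, 'k::comm_ring_1) mpoly set"
  assumes I: "is_ideal I" and R: "R = subalg G" and Gor: "Gorenstein R m I"
  obtains a t where "trace_form R I a t"
proof -
  define A where "A = coord_ring I"
  define D where "D = dualizing_module R m I"
  define N :: "(('v, 'k) mpoly, ('v, 'k) mpoly) gmodule"
    where "N = gshift (submod R) (- int (m + 1))"
  have A_simps: "gcarrier A = range (coset I)" "gpiece A l = coset I ` forms l"
    "gadd A (coset I p) (coset I q) = coset I (p + q)"
    "gsmult A p (coset I q) = coset I (p * q)" for l p q
    unfolding A_def quotmod_add_coset[OF I] quotmod_smult_coset[OF I]
    by (simp_all add: quotmod_def)
  have N_simps: "gcarrier N = R" "gadd N = (+)" "gsmult N = (*)"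
    "gpiece N l = R \<inter> forms (l - int (m + 1))" for l
    by (simp_all add: N_def gshift_def submod_def algebra_simps)
  have D_simps: "gcarrier D = ghoms R A N"
    "gsmult D p \<tau> = (\<lambda>x\<in>gcarrier A. \<tau> (gsmult A p x))"
    "gpiece D l = {\<tau> \<in> ghoms R A N. \<forall>j. \<forall>x\<in>gpiece A j. \<tau> x \<in> gpiece N (j + l)}" for p \<tau> l
    by (simp_all add: D_def dualizing_module_def gHom_def A_def N_def)
  obtain a where "giso UNIV D (gshift A a)"
    using Gor by (auto simp: Gorenstein_def D_def A_def)
  then obtain \<theta> where hom: "\<theta> \<in> ghoms UNIV D (gshift A a)"
    and bij: "bij_betw \<theta> (gcarrier D) (gcarrier A)"
    and pieces: "\<And>l. \<theta> ` gpiece D l = gpiece A (a + l)"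
    by (auto simp: giso_def gshift_def)
  \<comment> \<open>The piece of degree \<open>- a\<close> is mapped onto the piece of degree 0 of
    the coordinate ring, which contains 1.\<close>
  have "coset I 1 \<in> \<theta> ` gpiece D (- a)"
    unfolding pieces A_simps using one_in_forms by auto
  then obtain \<tau> where \<theta>\<tau>: "\<theta> \<tau> = coset I 1" and \<tau>: "\<tau> \<in> gpiece D (- a)"
    by auto
  define t where "t p = \<tau> (coset I p)" for p
  have \<tau>_hom: "\<tau> \<in> ghoms R A N"
    using \<tau> by (simp add: D_simps)
  have t_in: "t p \<in> R" for p
    using \<tau>_hom by (auto simp: ghoms_def A_simps N_simps t_def)
  have t_add: "t (p + q) = t p + t q" for p q
    using \<tau>_hom by (simp add: ghoms_def A_simps N_simps t_def)
  have t_scale: "t (r * p) = r * t p" if "r \<in> R" for r p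
    using \<tau>_hom that by (simp add: ghoms_def A_simps N_simps t_def)
  have t_0: "t 0 = 0"
    using t_add[of 0 0] by simp
  have smult_\<tau>: "gsmult D p \<tau> (coset I f) = t (p * f)" for p f
    by (simp add: D_simps A_simps t_def)
  have smult_in: "gsmult D p \<tau> \<in> ghoms R A N" for p
  proof -
    have "t (p * (f + g)) = t (p * f) + t (p * g)" for f g
      by (simp add: distrib_left t_add)
    moreover have "t (p * (r * f)) = r * t (p * f)" if "r \<in> R" for r f
      using t_scale[OF that, of "p * f"] by (simp only: mult.left_commute)
    ultimately show ?thesis
      by (auto simp: ghoms_def A_simps(1,3,4) N_simps smult_\<tau> t_in)
        (auto simp: D_simps A_simps)
  qed
  \<comment> \<open>Thus \<theta> recovers \<open>p\<close> modulo \<open>I\<close> from the linear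
    form \<open>f \<mapsto> t (p * f)\<close>.\<close>
  have \<theta>_smult: "\<theta> (gsmult D p \<tau>) = coset I p" for p
  proof -
    have "\<theta> (gsmult D p \<tau>) = gsmult A p (\<theta> \<tau>)"
      using hom \<tau>_hom by (simp add: ghoms_def gshift_def D_simps(1))
    then show ?thesis
      by (simp add: \<theta>\<tau> A_simps)
  qed
  \<comment> \<open>The summand \<open>m + 1\<close> comes from the shift of \<open>R\<close> in the
    dualizing module.\<close>
  have "trace_form R I (a + int (m + 1)) t"
  proof
    show "t p = 0" if "p \<in> I" for p
      using coset_eq_iff[OF I, of p 0] that t_0 by (simp add: t_def)
    show "t p \<in> forms (l - (a + int (m + 1)))" if "p \<in> forms l" for p l
    proof -
      have "\<forall>x\<in>gpiece A l. \<tau> x \<in> gpiece N (l + - a)"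
        using \<tau> unfolding D_simps by blast
      then have "t p \<in> forms (l + - a - int (m + 1))"
        using that unfolding A_simps N_simps t_def by blast
      then show ?thesis
        by (simp add: algebra_simps)
    qed
    show "p \<in> I" if "\<And>f. t (p * f) = 0" for p
    proof -
      have "gsmult D p \<tau> = gsmult D 0 \<tau>"
      proof
        fix x
        show "gsmult D p \<tau> x = gsmult D 0 \<tau> x"
        proof (cases "x \<in> gcarrier A")
          case True
          then obtain f where "x = coset I f"
            by (auto simp: A_simps)
          then show ?thesis
            by (simp add: smult_\<tau> that t_0)
        qed (simp add: D_simps)
      qed
      then have "coset I p = coset I 0"
        by (metis \<theta>_smult)
      then show ?thesis
        by (simp add: coset_eq_iff[OF I])
    qed
    show "\<exists>p. \<forall>f. \<psi> f = t (p * f)"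
      if \<psi>_in: "\<And>f. \<psi> f \<in> R" and \<psi>_add: "\<And>f g. \<psi> (f + g) = \<psi> f + \<psi> g"
        and \<psi>_scale: "\<And>r f. r \<in> R \<Longrightarrow> \<psi> (r * f) = r * \<psi> f"
        and \<psi>_zero: "\<And>f. f \<in> I \<Longrightarrow> \<psi> f = 0" for \<psi>
    proof -
      \<comment> \<open>\<psi> descends to cosets: it is additive and vanishes on \<open>I\<close>,
        so the chosen representative does not matter.\<close>
      define \<Psi> where "\<Psi> = (\<lambda>x\<in>gcarrier A. \<psi> (SOME f. x = coset I f))"
      have \<Psi>: "\<Psi> (coset I f) = \<psi> f" for f
      proof -
        let ?g = "SOME g. coset I f = coset I g"
        have "coset I f = coset I ?g"
          by (rule someI[of _ f]) simp
        then have "\<psi> (f - ?g) = 0"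
          by (intro \<psi>_zero) (simp only: coset_eq_iff[OF I])
        then show ?thesis
          using \<psi>_add[of "f - ?g" ?g] by (simp add: \<Psi>_def A_simps)
      qed
      have \<Psi>_hom: "\<Psi> \<in> ghoms R A N"
        by (auto simp: ghoms_def A_simps(1,3,4) N_simps \<Psi> \<psi>_in \<psi>_add \<psi>_scale)
          (auto simp: \<Psi>_def A_simps)
      then have "\<theta> \<Psi> \<in> gcarrier A"
        using bij by (auto simp: bij_betw_def D_simps)
      then obtain p where "\<theta> \<Psi> = coset I p"
        by (auto simp: A_simps)
      then have "\<theta> \<Psi> = \<theta> (gsmult D p \<tau>)"
        by (simp only: \<theta>_smult)
      then have "\<Psi> = gsmult D p \<tau>"
        using inj_onD[OF bij_betw_imp_inj_on[OF bij]] \<Psi>_hom smult_in by (simp add: D_simps(1))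
      then have "\<psi> f = t (p * f)" for f
        using \<Psi>[of f] by (simp only: smult_\<tau>)
      then show ?thesis
        by blast
    qed
  qed (use t_add t_scale in auto)
  then show thesis
    by (rule that)
qed

section \<open>Saturation of the section and the residual ideal\<close>

text \<open>Regularity of \<open>g\<close> modulo \<open>f\<close> extends to powers of
  \<open>f\<close>: write \<open>p = f u\<close> modulo \<open>I\<close>, cancel one factor
  \<open>f\<close>, and apply the induction hypothesis to \<open>u\<close>.\<close>

lemma regular_pair_power_left:
  fixes I :: "'a::comm_ring_1 set"
  assumes I: "is_ideal I"
    and f: "\<And>p. f * p \<in> I \<Longrightarrow> p \<in> I"
    and g: "\<And>p w. g * p - f * w \<in> I \<Longrightarrow> \<exists>v. p - f * v \<in> I"
  shows "g * p - f ^ k * w \<in> I \<Longrightarrow> \<exists>v. p - f ^ k * v \<in> I"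
proof (induction k arbitrary: p w)
  case 0
  show ?case
    using ideal.subspace_0[OF I] by (intro exI[of _ p]) simp
next
  case (Suc k)
  have "g * p - f * (f ^ k * w) \<in> I"
    using Suc.prems by (simp add: mult.assoc)
  then obtain u where u: "p - f * u \<in> I"
    using g by blast
  have "f * (g * u - f ^ k * w) = (g * p - f ^ Suc k * w) - g * (p - f * u)"
    by (simp add: algebra_simps)
  also have "\<dots> \<in> I"
    by (rule ideal.subspace_diff[OF I Suc.prems ideal.subspace_scale[OF I u]])
  finally obtain v where v: "u - f ^ k * v \<in> I"
    using f Suc.IH by blast
  have "p - f ^ Suc k * v = (p - f * u) + f * (u - f ^ k * v)"
    by (simp add: algebra_simps)
  also have "\<dots> \<in> I"
    by (rule ideal.subspace_add[OF I u ideal.subspace_scale[OF I v]])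
  finally show ?case
    by blast
qed

lemma regular_pair_power:
  fixes I :: "'a::comm_ring_1 set"
  assumes I: "is_ideal I"
    and f: "\<And>p. f * p \<in> I \<Longrightarrow> p \<in> I"
    and g: "\<And>p w. g * p - f * w \<in> I \<Longrightarrow> \<exists>v. p - f * v \<in> I"
  shows "g ^ j * p - f ^ k * w \<in> I \<Longrightarrow> \<exists>v. p - f ^ k * v \<in> I"
proof (induction j arbitrary: p w)
  case 0
  then show ?case
    by auto
next
  case (Suc j)
  have "g ^ j * (g * p) - f ^ k * w \<in> I"
    using Suc.prems by (simp add: mult_ac)
  then obtain v where "g * p - f ^ k * v \<in> I"
    using Suc.IH by blast
  from regular_pair_power_left[OF I f g this] show ?case .
qed

lemma power_cancel:
  fixes I :: "'a::comm_ring_1 set"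
  assumes f: "\<And>p. f * p \<in> I \<Longrightarrow> p \<in> I"
  shows "f ^ k * p \<in> I \<Longrightarrow> p \<in> I"
  by (induction k) (auto simp: mult.assoc intro: f)

text \<open>Every monomial of degree \<open>N + 1\<close> is a variable times a monomial of degree
  \<open>N\<close>.\<close>

lemma forms_annihilate_Suc:
  fixes K :: "('v, 'k::comm_ring_1) mpoly set"
  assumes K: "is_ideal K" and N: "\<And>q. q \<in> forms (int N) \<Longrightarrow> q * p \<in> K"
    and q: "q \<in> forms (int (Suc N))"
  shows "q * p \<in> K"
proof -
  have "Poly_Mapping.single t c * p \<in> K" if "tdeg t = Suc N" for t c
  proof -
    have "t \<noteq> 0"
      using that by auto
    then obtain v where v: "Poly_Mapping.lookup t v \<noteq> 0"
      by (metis lookup_zero poly_mapping_eqI)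
    define u where "u = t - Poly_Mapping.single v 1"
    have t: "t = Poly_Mapping.single v 1 + u"
      using v by (intro poly_mapping_eqI) (auto simp: u_def lookup_add lookup_minus lookup_single when_def)
    have "tdeg (Poly_Mapping.single v (1::nat)) = 1"
      by (simp add: tdeg_def)
    then have "tdeg u = N"
      using that tdeg_add[of "Poly_Mapping.single v 1" u] t by simp
    then have "Poly_Mapping.single u c * p \<in> K"
      using single_in_forms[of u c] by (intro N) simp
    then have "Poly_Mapping.single (Poly_Mapping.single v 1) 1 * (Poly_Mapping.single u c * p) \<in> K"
      by (rule ideal.subspace_scale[OF K])
    moreover have "Poly_Mapping.single t c =
        Poly_Mapping.single (Poly_Mapping.single v 1) 1 * Poly_Mapping.single u c"
      by (subst t) (simp add: mult_single)
    ultimately show ?thesis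
      by (simp only: mult.assoc)
  qed
  then have "(\<Sum>t\<in>Poly_Mapping.keys q. Poly_Mapping.single t (Poly_Mapping.lookup q t) * p) \<in> K"
    using q by (intro ideal.subspace_sum[OF K]) (auto simp: forms_def)
  then show ?thesis
    by (subst poly_mapping_sum_keys[of q]) (simp add: sum_distrib_right)
qed

lemma forms_annihilate_mono:
  fixes K :: "('v, 'k::comm_ring_1) mpoly set"
  assumes K: "is_ideal K" and N: "\<And>q. q \<in> forms (int N) \<Longrightarrow> q * p \<in> K" and "N \<le> N'"
  shows "q \<in> forms (int N') \<Longrightarrow> q * p \<in> K"
  using \<open>N \<le> N'\<close>
proof (induction N' arbitrary: q rule: dec_induct)
  case base
  then show ?case
    by (rule N)
next
  case (step n)
  from step.IH step.prems show ?case
    by (rule forms_annihilate_Suc[OF K])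
qed

text \<open>A form of degree at most 0 is a constant. The constant 0 is no nonzerodivisor modulo the
  proper ideal \<open>K\<close>, and a nonzero constant would make \<open>K'\<close> the whole
  ring.\<close>

lemma form_degree_pos:
  fixes K K' :: "('v, 'k::field) mpoly set"
  assumes f: "f \<in> forms l" and K: "is_ideal K" and cut: "cuts_properly K f"
    and K': "is_ideal K'" "K \<subseteq> K'" "K' \<noteq> UNIV" "f \<in> K'"
  shows "l \<ge> 1"
proof (rule ccontr)
  assume "\<not> l \<ge> 1"
  have not_1: "1 \<notin> K'"
    using ideal.subspace_scale[OF K'(1), of 1] K'(3) by auto
  define a where "a = Poly_Mapping.lookup f 0"
  have f_eq: "f = Poly_Mapping.single 0 a"
  proof (rule poly_mapping_eqI)
    fix t :: "'v \<Rightarrow>\<^sub>0 nat"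
    have "t \<noteq> 0 \<Longrightarrow> tdeg t > 0"
      using tdeg_eq_0_iff[of t] by simp
    then show "Poly_Mapping.lookup f t = Poly_Mapping.lookup (Poly_Mapping.single 0 a) t"
      using formsD[OF f, of t] \<open>\<not> l \<ge> 1\<close> by (cases "t = 0") (auto simp: lookup_single when_def a_def)
  qed
  show False
  proof (cases "a = 0")
    case True
    then have "f * 1 \<in> K"
      using f_eq ideal.subspace_0[OF K] by simp
    then have "1 \<in> K"
      using cut unfolding cuts_properly_iff[OF K] by blast
    with not_1 K'(2) show False
      by auto
  next
    case False
    then have "Poly_Mapping.single 0 (inverse a) * f = 1"
      by (simp add: f_eq mult_single)
    with ideal.subspace_scale[OF K'(1) K'(4), of "Poly_Mapping.single 0 (inverse a)"] not_1
    show False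
      by simp
  qed
qed

text \<open>
  A regular sequence of length two on \<open>A/I\<close> makes the depth of \<open>A/(I + (h))\<close> positive: from
  \<open>f\<^sup>k p = h u\<close> and \<open>g\<^sup>j p = h v\<close> modulo \<open>I\<close> one gets \<open>g\<^sup>j u = f\<^sup>k v\<close> after cancelling \<open>h\<close>, so
  \<open>u\<close> is a multiple of \<open>f\<^sup>k\<close>.
\<close>

lemma section_ideal_eq:
  fixes I :: "('v, 'k::field) mpoly set"
  assumes I: "is_ideal I" and ACM: "ACM I m" and m: "m \<ge> 1" and h: "cuts_properly I h"
  shows "section_ideal I h = ideal_of (I \<union> {h})"
proof
  let ?K = "ideal_of (I \<union> {h})"
  have K: "is_ideal ?K"
    by (rule ideal.subspace_span)
  show "?K \<subseteq> section_ideal I h"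
    using ideal.subspace_scale[OF K] by (auto simp: section_ideal_def saturation_def)
  show "section_ideal I h \<subseteq> ?K"
  proof
    fix p assume "p \<in> section_ideal I h"
    then obtain N where N: "\<And>q. q \<in> forms (int N) \<Longrightarrow> q * p \<in> ?K"
      by (auto simp: section_ideal_def saturation_def)
    obtain fs where fs: "length fs = m + 1" "\<forall>f\<in>set fs. \<exists>l. f \<in> forms l" "regular_seq I fs"
      using ACM by (auto simp: ACM_def)
    have *: "is_ideal (ideal_of S)" for S :: "('v, 'k) mpoly set"
      by (rule ideal.subspace_span)
    have cut: "cuts_properly (ideal_of (I \<union> set (take i fs))) (fs ! i)" if "i < length fs" for i
      using fs(3) that by (simp add: regular_seq_def)
    have power_p: "\<exists>w. (fs ! i) ^ N * p - h * w \<in> I" if i: "i < length fs" for i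
    proof -
      obtain l where l: "fs ! i \<in> forms l"
        using fs(2) i by force
      \<comment> \<open>Positive degree gives the \<open>N\<close>-th power degree at least
        \<open>N\<close>, so that it multiplies \<open>p\<close> into \<open>?K\<close>.\<close>
      have "l \<ge> 1"
      proof (rule form_degree_pos[OF l * cut[OF i] *])
        show "ideal_of (I \<union> set (take i fs)) \<subseteq> ideal_of (I \<union> set fs)"
          by (intro ideal.span_mono) (auto dest: in_set_takeD)
        show "ideal_of (I \<union> set fs) \<noteq> UNIV"
          using fs(3) by (simp add: regular_seq_def)
        show "fs ! i \<in> ideal_of (I \<union> set fs)"
          by (rule ideal.span_base) (simp add: i)
      qed
      then obtain k where k: "l = int k" "N \<le> N * k"
        using zero_le_imp_eq_int[of l] by fastforce
      have "(fs ! i) ^ N * p \<in> ?K"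
        using forms_power[OF l, of N] by (intro forms_annihilate_mono[OF K N k(2)]) (simp_all add: k(1))
      then show ?thesis
        by (simp only: ideal_of_insert_iff[OF I])
    qed
    define f g where "f = fs ! 0" and "g = fs ! 1"
    have span_I: "ideal_of I = I"
      using I by (simp only: ideal.span_eq_iff)
    have f: "q \<in> I" if "f * q \<in> I" for q
      using cut[of 0] fs(1) that cuts_properly_iff[OF I] by (simp add: f_def span_I)
    have "set (take 1 fs) = {f}"
      using fs(1) by (cases fs) (auto simp: f_def)
    then have "cuts_properly (ideal_of (I \<union> {f})) g"
      using cut[of 1] fs(1) m by (simp add: g_def)
    then have g: "\<exists>v. q - f * v \<in> I" if "g * q - f * w \<in> I" for q w
      using that unfolding cuts_properly_iff[OF *] ideal_of_insert_iff[OF I] by blast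
    obtain u v where u: "f ^ N * p - h * u \<in> I" and v: "g ^ N * p - h * v \<in> I"
      using power_p[of 0] power_p[of 1] fs(1) m by (auto simp: f_def g_def)
    have "h * (g ^ N * u - f ^ N * v) = f ^ N * (g ^ N * p - h * v) - g ^ N * (f ^ N * p - h * u)"
      by (simp add: algebra_simps)
    also have "\<dots> \<in> I"
      by (intro ideal.subspace_diff[OF I] ideal.subspace_scale[OF I] u v)
    finally have "g ^ N * u - f ^ N * v \<in> I"
      using h unfolding cuts_properly_iff[OF I] by blast
    then have "\<exists>w. u - f ^ N * w \<in> I"
      by (rule regular_pair_power[OF I f g, rotated -1])
    then obtain w where w: "u - f ^ N * w \<in> I" ..
    have "f ^ N * (p - h * w) = (f ^ N * p - h * u) + h * (u - f ^ N * w)"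
      by (simp add: algebra_simps)
    also have "\<dots> \<in> I"
      by (intro ideal.subspace_add[OF I] ideal.subspace_scale[OF I] u w)
    finally have "p - h * w \<in> I"
      by (rule power_cancel[OF f, rotated])
    then show "p \<in> ?K"
      unfolding ideal_of_insert_iff[OF I] by blast
  qed
qed

text \<open>Multiplication by \<open>g\<close> is a homomorphism from \<open>J\<close> to
  \<open>Z\<close>, hence by linkage is multiplication by some \<open>g'\<close> in
  \<open>J'\<close>. Evaluation at the nonzerodivisor \<open>h\<close> identifies \<open>g\<close>
  with \<open>g'\<close> modulo \<open>I\<close>.\<close>

lemma linked_colon:
  fixes J :: "('v, 'k::comm_ring_1) mpoly set"
  assumes link: "linked_in J J' Z" and h: "h \<in> J" and cut: "\<And>p. h * p \<in> I \<Longrightarrow> p \<in> I"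
    and I: "is_ideal I" "I \<subseteq> J'" and J: "is_ideal J" and J': "is_ideal J'"
    and g: "\<And>f. f \<in> J \<Longrightarrow> g * f \<in> Z"
  shows "g \<in> J'"
proof -
  have "(\<lambda>f\<in>J. g * f) \<in> gcarrier (gHom UNIV (submod J) (submod Z))"
    using g ideal.subspace_add[OF J] ideal.subspace_scale[OF J]
    by (auto simp: gHom_def ghoms_def submod_def distrib_left mult.left_commute)
  then obtain g' where g': "g' \<in> J'" "(\<lambda>f\<in>J. g * f) = (\<lambda>f\<in>J. g' * f)"
    using link unfolding linked_in_def bij_betw_def by (metis (no_types, lifting) imageE)
  from fun_cong[OF g'(2), of h] h have "h * (g - g') = 0"
    by (simp add: algebra_simps)
  then have "g - g' \<in> J'"
    using cut[of "g - g'"] I ideal.subspace_0[OF I(1)] by auto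
  then show ?thesis
    using ideal.subspace_add[OF J' _ g'(1)] by fastforce
qed

section \<open>The degree of the trace and the conclusion\<close>

theorem mainTheorem8:
  fixes I J J' :: "('v::{finite,linorder}, 'k::{alg_closed_field,field_char_0}) mpoly set"
    and L :: "nat \<Rightarrow> ('v, 'k) mpoly"
    and h :: "('v, 'k) mpoly"
    and n m d s :: nat
    and \<mu> \<nu> \<nu>' :: "nat \<Rightarrow> int"
  assumes "CARD('v) = n + 1"
    and "m \<ge> 1"
    and "proj_subscheme I" and "pure_dim I m" and "has_degree I m d"
    and "linear_parameters I m L"
    and "Gorenstein (Rm L m) m I"
    and "char_seq (Rm L m) I d \<mu>"
    and "ACM_hypersurface I m J" and "ACM_hypersurface I m J'"
    and "rel_char_seq (Rm L m) I J d \<nu>" and "rel_char_seq (Rm L m) I J' d \<nu>'"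
    and "s \<ge> 1" and "h \<in> forms (int s)" and "cuts_properly I h"
    and "linked_in J J' (section_ideal I h)"
  shows "\<forall>i<d. \<nu> i + \<nu>' (d - 1 - i) = \<mu> (d - 1) + int s"
proof (intro allI impI)
  fix i assume i: "i < d"
  define R where "R = Rm L m"
  have hom_I: "hom_ideal I" and I: "is_ideal I"
    using \<open>proj_subscheme I\<close> by (simp_all add: proj_subscheme_def hom_ideal_def)
  have J: "is_ideal J" "I \<subseteq> J" and J': "is_ideal J'" "I \<subseteq> J'"
    using \<open>ACM_hypersurface I m J\<close> \<open>ACM_hypersurface I m J'\<close>
    by (simp_all add: ACM_hypersurface_def proj_subscheme_def hom_ideal_def)
  have nzd: "p \<in> I" if "h * p \<in> I" for p
    using \<open>cuts_properly I h\<close> that unfolding cuts_properly_iff[OF I] by blast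
  have "ACM I m"
    using \<open>Gorenstein (Rm L m) m I\<close> by (simp add: Gorenstein_def)
  \<comment> \<open>As \<open>I + (h)\<close> is already saturated, membership in the section is
    divisibility by \<open>h\<close> modulo \<open>I\<close>.\<close>
  then have section_iff: "p \<in> section_ideal I h \<longleftrightarrow> (\<exists>w. p - h * w \<in> I)" for p
    using section_ideal_eq[OF I _ \<open>m \<ge> 1\<close> \<open>cuts_properly I h\<close>] ideal_of_insert_iff[OF I] by simp
  have section_eq: "section_ideal I h = J \<inter> J'"
    using \<open>linked_in J J' (section_ideal I h)\<close> by (simp add: linked_in_def)
  obtain a t where t: "trace_form R I a t"
    using trace_form_of_Gorenstein[OF I R_def] \<open>Gorenstein (Rm L m) m I\<close> unfolding R_def by blast
  have UNIV_ideal: "is_ideal (UNIV :: ('v, 'k) mpoly set)"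
    by (simp add: ideal.subspace_def)
  have R0: "0 \<in> R"
    by (simp add: R_def)

  have \<mu>: "\<mu> 0 = 0" "mono_on {..<d} \<mu>"
    using \<open>char_seq (Rm L m) I d \<mu>\<close> by (simp_all add: char_seq_def)
  obtain b c where bc: "graded_basis R I UNIV d \<mu> b c"
    using graded_basis_of_giso[OF I UNIV_ideal _ R_def] \<open>char_seq (Rm L m) I d \<mu>\<close>
    unfolding R_def char_seq_def by blast
  obtain \<sigma> where "\<sigma> permutes {..<d}" "\<And>i. i < d \<Longrightarrow> \<mu> i + \<mu> (\<sigma> i) = a + 0"
  proof (rule linkage_pairing_permutation[OF bc bc t hom_I UNIV_ideal R0 one_in_forms])
    show "\<exists>w. f * g - 1 * w \<in> I" for f g
      using ideal.subspace_0[OF I] by (intro exI[of _ "f * g"]) simp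
  qed simp_all
  \<comment> \<open>The index 0 determines the trace degree, since
    \<open>\<mu> 0 = 0\<close>.\<close>
  from permuted_complement_sorted[OF \<mu>(2) \<mu>(2) this, of 0] have a: "a = \<mu> (d - 1)"
    using i \<mu>(1) by simp

  obtain b c where bc: "graded_basis R I J d \<nu> b c"
    using graded_basis_of_giso[OF I J R_def] \<open>rel_char_seq (Rm L m) I J d \<nu>\<close>
    unfolding R_def rel_char_seq_def by blast
  obtain b' c' where bc': "graded_basis R I J' d \<nu>' b' c'"
    using graded_basis_of_giso[OF I J' R_def] \<open>rel_char_seq (Rm L m) I J' d \<nu>'\<close>
    unfolding R_def rel_char_seq_def by blast
  have "\<exists>w. h - h * w \<in> I"
    using ideal.subspace_0[OF I] by (intro exI[of _ 1]) simp
  then have hJ: "h \<in> J"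
    using section_eq section_iff by blast
  \<comment> \<open>Now the pairing of \<open>J\<close> with \<open>J'\<close>: products lie in the
    section \<open>J \<inter> J'\<close>, and the linkage supplies the ideal quotient
    condition.\<close>
  obtain \<sigma> where "\<sigma> permutes {..<d}" "\<And>i. i < d \<Longrightarrow> \<nu> i + \<nu>' (\<sigma> i) = a + int s"
  proof (rule linkage_pairing_permutation[OF bc bc' t hom_I J(1) R0 \<open>h \<in> forms (int s)\<close> hJ nzd _ _ J(2)])
    show "\<exists>w. f * g - h * w \<in> I" if "f \<in> J" "g \<in> J'" for f g
    proof -
      have "f * g \<in> J \<inter> J'"
        using ideal.subspace_scale[OF J(1) that(1), of g] ideal.subspace_scale[OF J'(1) that(2), of f]
        by (simp add: mult.commute)
      then show ?thesis
        unfolding section_eq[symmetric] section_iff .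
    qed
    show "g \<in> J'" if colon: "\<And>f. f \<in> J \<Longrightarrow> \<exists>w. g * f - h * w \<in> I" for g
    proof (rule linked_colon[OF \<open>linked_in J J' (section_ideal I h)\<close> hJ nzd I J'(2) J(1) J'(1)])
      show "g * f \<in> section_ideal I h" if "f \<in> J" for f
        unfolding section_iff by (rule colon[OF that])
    qed
  qed (assumption, rule that)
  moreover have "mono_on {..<d} \<nu>" "mono_on {..<d} \<nu>'"
    using \<open>rel_char_seq (Rm L m) I J d \<nu>\<close> \<open>rel_char_seq (Rm L m) I J' d \<nu>'\<close>
    by (simp_all add: rel_char_seq_def)
  ultimately show "\<nu> i + \<nu>' (d - 1 - i) = \<mu> (d - 1) + int s"
    using permuted_complement_sorted[of d \<nu> \<nu>' \<sigma> "a + int s" i] i by (simp add: a)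
qed

end
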